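(* If $0<\varepsilon<2$ and $\lambda$ is a real eigenvalue of $A_+$, then $\lambda>1$.
   Context: Let $\mathbf{Z}_+=\{1,2,3,\dots\}$ and let $l^2(\mathbf{Z}_+)$ be the usual complex Hilbert space of square-summable sequences. For $\varepsilon>0$, $A_+$ is the (unbounded, closed) operator on $l^2(\mathbf{Z}_+)$ given by $$(A_+v)_n=\frac{\varepsilon}{2}\,n(n-1)\,v_{n-1}-\frac{\varepsilon}{2}\,n(n+1)\,v_{n+1}+n\,v_n,\qquad n\ge 1,$$ where for $n=1$ the first term is $0$, with its natural maximal domain, i.e. the set of all $v\in l^2(\mathbf{Z}_+)$ for which the sequence $A_+v$ defined by this formula belongs to $l^2(\mathbf{Z}_+)$. An eigenvalue of $A_+$ is a number $\lambda$ for which there is a nonzero $v$ in the domain with $A_+v=\lambda v$. *)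

theory Defs imports Complex_Main begin

text \<open>
  A sequence indexed by the positive integers is represented by a function on \<^typ>\<open>nat\<close>
  whose value at the unused index 0 is 0, so that equality of functions is equality of
  sequences and the zero sequence is the zero function.
\<close>

definition l2_pos :: "(nat \<Rightarrow> complex) set" where
  "l2_pos = {v. v 0 = 0 \<and> summable (\<lambda>n. (cmod (v n))\<^sup>2)}"

text \<open>
  The factor \<open>real n - 1\<close> is 0 for \<open>n = 1\<close>, hence the first summand vanishes there.
\<close>

definition A_plus :: "real \<Rightarrow> (nat \<Rightarrow> complex) \<Rightarrow> nat \<Rightarrow> complex" where
  "A_plus \<epsilon> v = (\<lambda>n. if n = 0 then 0 else
      of_real (\<epsilon> / 2 * real n * (real n - 1)) * v (n - 1)
    - of_real (\<epsilon> / 2 * real n * (real n + 1)) * v (n + 1)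
    + of_nat n * v n)"

definition dom_A_plus :: "real \<Rightarrow> (nat \<Rightarrow> complex) set" where
  "dom_A_plus \<epsilon> = {v \<in> l2_pos. A_plus \<epsilon> v \<in> l2_pos}"

definition eigenvalue_A_plus :: "real \<Rightarrow> complex \<Rightarrow> bool" where
  "eigenvalue_A_plus \<epsilon> \<mu> \<longleftrightarrow>
    (\<exists>v \<in> dom_A_plus \<epsilon>. v \<noteq> (\<lambda>n. 0) \<and> A_plus \<epsilon> v = (\<lambda>n. \<mu> * v n))"

end

theory Submission imports Defs "HOL-Analysis.Summation_Tests" begin

text \<open>
  Let \<open>v\<close> be an eigenvector for a real eigenvalue \<open>l\<close>. Dividing the \<open>n\<close>-th eigenvalue equation by
  \<open>\<epsilon> n / 2\<close> gives \<open>(n + 1) v\<^sub>n\<^sub>+\<^sub>1 = (n - 1) v\<^sub>n\<^sub>-\<^sub>1 + (2 / \<epsilon>) (1 - l / n) v\<^sub>n\<close>, whose coefficients are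
  real. Hence \<open>x\<^sub>n = |v\<^sub>n|\<^sup>2\<close> and the correlation \<open>c\<^sub>n = Re (v\<^sub>n cnj v\<^sub>n\<^sub>+\<^sub>1)\<close> of neighbouring entries
  satisfy \<open>(n + 1) c\<^sub>n - (n - 1) c\<^sub>n\<^sub>-\<^sub>1 = (2 / \<epsilon>) (1 - l / n) x\<^sub>n\<close>
  (lemma \<open>correlation_recurrence\<close>).

  Suppose \<open>l \<le> 1\<close>. The right-hand side is then nonnegative for every \<open>n \<ge> 1\<close>, so all \<open>c\<^sub>n\<close> are
  nonnegative. As \<open>\<epsilon> < 2\<close>, the factor of \<open>x\<^sub>n\<close> exceeds 1 for large \<open>n\<close>; together with
  \<open>2 c\<^sub>n \<le> x\<^sub>n + x\<^sub>n\<^sub>+\<^sub>1\<close> this yields \<open>n c\<^sub>n - (n - 1) c\<^sub>n\<^sub>-\<^sub>1 \<ge> (x\<^sub>n - x\<^sub>n\<^sub>+\<^sub>1) / 2\<close>. In other words,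
  \<open>n c\<^sub>n + x\<^sub>n\<^sub>+\<^sub>1 / 2\<close> is eventually nondecreasing. It becomes positive, because a nonzero
  eigenvector has no two consecutive zeros (lemma \<open>recurrence_consecutive_zeros\<close>). Since \<open>x\<^sub>n\<close>
  tends to 0, the products \<open>n c\<^sub>n\<close> stay above a positive constant, and \<open>\<Sum> c\<^sub>n\<close> diverges like the
  harmonic series (lemma \<open>summable_imp_frequently_small\<close>). But \<open>\<Sum> c\<^sub>n\<close> is dominated by \<open>2 \<Sum> x\<^sub>n\<close>,
  which is finite for \<open>v\<close> in \<open>l\<^sup>2\<close>.
\<close>

lemma eigenvector_recurrence:
  fixes \<epsilon> l :: real
  assumes "\<epsilon> > 0" and "A_plus \<epsilon> v = (\<lambda>n. complex_of_real l * v n)"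
  shows "of_nat (n + 2) * v (n + 2)
    = of_nat n * v n + of_real (2 / \<epsilon> * (1 - l / real (n + 1))) * v (n + 1)"
proof -
  define m where "m = complex_of_nat (n + 1)"
  define e where "e = complex_of_real \<epsilon>"
  define b where "b = complex_of_real (2 / \<epsilon> * (1 - l / real (n + 1)))"
  have nz: "m \<noteq> 0" "e \<noteq> 0"
    using assms(1) of_nat_neq_0[of n, where 'a = complex] by (simp_all add: m_def e_def)
  have "A_plus \<epsilon> v (n + 1) = l * v (n + 1)"
    using assms(2) by simp
  then have "e / 2 * m * (m - 1) * v n - e / 2 * m * (m + 1) * v (n + 2) + m * v (n + 1)
      = l * v (n + 1)"
    by (simp add: A_plus_def m_def e_def)
  moreover have "b * (m * e) = 2 * (m - l)"
  proof -
    have "2 / \<epsilon> * (1 - l / r) * (r * \<epsilon>) = 2 * (r - l)" if "r > 0" for r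
      using assms(1) that by (simp add: field_simps)
    from this[of "real (n + 1)"] have "complex_of_real (2 / \<epsilon> * (1 - l / real (n + 1)) * (real (n + 1) * \<epsilon>))
        = complex_of_real (2 * (real (n + 1) - l))"
      by (intro arg_cong[where f = complex_of_real]) simp
    then show ?thesis
      by (simp only: m_def e_def b_def of_real_mult of_real_diff of_real_of_nat_eq of_real_numeral)
  qed
  ultimately have "(m + 1) * v (n + 2) * (m * e) = ((m - 1) * v n + b * v (n + 1)) * (m * e)"
    by algebra
  then have "(m + 1) * v (n + 2) = (m - 1) * v n + b * v (n + 1)"
    using nz by simp
  then show ?thesis
    by (simp add: m_def b_def)
qed

text \<open>
  Two adjacent zeros propagate backwards through the coefficients \<open>n \<noteq> 0\<close> down to index 1, and
  from indices 0 and 1 forwards through the coefficients \<open>n + 2\<close>. The separate condition \<open>v 0 = 0\<close>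
  replaces the backward step at \<open>n = 0\<close>, where the coefficient vanishes.
\<close>

lemma recurrence_consecutive_zeros:
  fixes v :: "nat \<Rightarrow> complex" and b :: "nat \<Rightarrow> complex"
  assumes rec: "\<And>n. of_nat (n + 2) * v (n + 2) = of_nat n * v n + b n * v (n + 1)"
    and "v 0 = 0" "v N = 0" "v (Suc N) = 0"
  shows "v k = 0"
proof -
  have "v 1 = 0"
    using assms(3,4)
  proof (induction N)
    case (Suc N)
    have "v N = 0"
      using rec[of N] Suc.prems \<open>v 0 = 0\<close> by (cases "N = 0") auto
    then show ?case
      using Suc by simp
  qed simp
  have "v k = 0 \<and> v (Suc k) = 0"
  proof (induction k)
    case (Suc k)
    then show ?case
      using rec[of k] of_nat_eq_0_iff[of "k + 2", where 'a = complex] by (simp del: of_nat_add)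
  qed (use \<open>v 0 = 0\<close> \<open>v 1 = 0\<close> in simp)
  then show ?thesis ..
qed

text \<open>
  Multiply the recurrence by \<open>cnj (v (n + 1))\<close> and take real parts: since \<open>b n\<close> is real and
  \<open>Re (z * cnj w)\<close> is symmetric, both outer terms become correlations of neighbours.
\<close>

lemma correlation_recurrence:
  fixes v :: "nat \<Rightarrow> complex" and b :: "nat \<Rightarrow> real"
  assumes "of_nat (n + 2) * v (n + 2) = of_nat n * v n + of_real (b n) * v (n + 1)"
  shows "real (n + 2) * Re (v (n + 1) * cnj (v (n + 2)))
    = real n * Re (v n * cnj (v (n + 1))) + b n * (cmod (v (n + 1)))\<^sup>2"
proof -
  have "Re (of_nat (n + 2) * v (n + 2) * cnj (v (n + 1)))
      = Re ((of_nat n * v n + of_real (b n) * v (n + 1)) * cnj (v (n + 1)))"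
    using assms by simp
  then show ?thesis
    unfolding cmod_power2 by (simp add: power2_eq_square algebra_simps)
qed

lemma twice_correlation_le:
  "2 * Re (z * cnj w) \<le> (cmod z)\<^sup>2 + (cmod w)\<^sup>2"
proof -
  have "0 \<le> (Re z - Re w)\<^sup>2 + (Im z - Im w)\<^sup>2"
    by simp
  then show ?thesis
    unfolding cmod_power2 by (simp add: power2_eq_square algebra_simps)
qed

text \<open>
  Otherwise a tail of \<open>f\<close> would dominate a positive multiple of the harmonic series.
\<close>

lemma summable_imp_frequently_small:
  fixes f :: "nat \<Rightarrow> real"
  assumes "summable f" "\<delta> > 0"
  shows "\<exists>n\<ge>N. real n * f n < \<delta>"
proof (rule ccontr)
  assume "\<not> ?thesis"
  then have large: "\<delta> \<le> real n * f n" if "n \<ge> N" for n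
    using that by (meson not_less)
  have "summable (\<lambda>n. \<delta> * inverse (real n))"
  proof (rule summable_comparison_test_ev[OF _ assms(1)])
    show "\<forall>\<^sub>F n in sequentially. norm (\<delta> * inverse (real n)) \<le> f n"
      using eventually_ge_at_top[of "max N 1"]
    proof eventually_elim
      case (elim n)
      then show ?case
        using large[of n] \<open>\<delta> > 0\<close> by (simp add: field_simps)
    qed
  qed
  with \<open>\<delta> > 0\<close> show False
    using not_summable_harmonic[where 'a = real] summable_mult_D[of \<delta>] by auto
qed

theorem theorem4:
  fixes \<epsilon> l :: real
  assumes "0 < \<epsilon>" and "\<epsilon> < 2"
    and "eigenvalue_A_plus \<epsilon> (complex_of_real l)"
  shows "l > 1"
proof (rule ccontr)
  assume "\<not> l > 1"
  obtain v where v0: "v 0 = 0" and summ: "summable (\<lambda>n. (cmod (v n))\<^sup>2)"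
    and nz: "v \<noteq> (\<lambda>n. 0)" and ev: "A_plus \<epsilon> v = (\<lambda>n. complex_of_real l * v n)"
    using assms(3) by (auto simp: eigenvalue_A_plus_def dom_A_plus_def l2_pos_def)
  define b where "b n = 2 / \<epsilon> * (1 - l / real (n + 1))" for n
  define c where "c n = Re (v n * cnj (v (Suc n)))" for n
  define x where "x n = (cmod (v n))\<^sup>2" for n
  have rec: "of_nat (n + 2) * v (n + 2) = of_nat n * v n + of_real (b n) * v (n + 1)" for n
    using eigenvector_recurrence[OF assms(1) ev] by (simp add: b_def)
  have crec: "real (n + 2) * c (Suc n) = real n * c n + b n * x (Suc n)" for n
    using correlation_recurrence[of n v b, OF rec] by (simp add: c_def x_def)
  have cx: "2 * c n \<le> x n + x (Suc n)" for n
    unfolding c_def x_def by (rule twice_correlation_le)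
  have "0 \<le> c n" for n
  proof (induction n)
    case (Suc n)
    have "0 \<le> b n"
      using \<open>\<not> l > 1\<close> \<open>\<epsilon> > 0\<close> by (simp add: b_def field_simps)
    then have "0 \<le> real (n + 2) * c (Suc n)"
      unfolding crec using Suc by (simp add: x_def)
    then show ?case
      by (simp add: zero_le_mult_iff)
  qed (simp add: c_def v0)

  have "b \<longlonglongrightarrow> 2 / \<epsilon> * (1 - 0)"
    unfolding b_def
    by (intro tendsto_intros LIMSEQ_ignore_initial_segment lim_const_over_n)
  moreover have "2 / \<epsilon> * (1 - 0) > 1"
    using assms by simp
  ultimately have "\<forall>\<^sub>F n in sequentially. b n > 1"
    by (rule order_tendstoD)
  then obtain N0 where N0: "b n > 1" if "n \<ge> N0" for n
    by (auto simp: eventually_sequentially)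
  obtain N where N: "N \<ge> N0" and vN: "v (Suc N) \<noteq> 0"
    using recurrence_consecutive_zeros[of v "\<lambda>n. of_real (b n)" "Suc N0", OF rec v0] nz
    by (metis le_Suc_eq order_refl)

  \<comment> \<open>In \<open>crec\<close> the factor on the left is one more than the index of \<open>c\<close>; bounding that surplus
      \<open>c\<close> by \<open>cx\<close> produces the term with \<open>x\<close> in \<open>Q\<close> and makes \<open>Q\<close> monotone.\<close>
  define Q where "Q n = real n * c n + x (Suc n) / 2" for n
  define \<delta> where "\<delta> = Q N"
  have "\<delta> > 0"
    unfolding \<delta>_def Q_def x_def using \<open>0 \<le> c N\<close> vN by (intro add_nonneg_pos) auto
  have Q_step: "Q n \<le> Q (Suc n)" if "n \<ge> N" for n
  proof -
    have "x (Suc n) \<le> b n * x (Suc n)"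
      using N0[of n] N that by (simp add: x_def mult_le_cancel_right1)
    then show ?thesis
      using crec[of n] cx[of "Suc n"] by (simp add: Q_def algebra_simps)
  qed
  have Q_ge: "\<delta> \<le> Q n" if "n \<ge> N" for n
    using that
  proof (induction rule: dec_induct)
    case (step n)
    then show ?case
      using Q_step[of n] by simp
  qed (simp add: \<delta>_def)

  have sx: "summable x"
    using summ by (simp add: x_def[abs_def])
  then have "summable (\<lambda>n. x n + x (Suc n))"
    by (intro summable_add) (simp_all add: summable_Suc_iff)
  then have sc: "summable c"
  proof (rule summable_comparison_test')
    show "norm (c n) \<le> x n + x (Suc n)" if "n \<ge> 0" for n
      using cx[of n] \<open>0 \<le> c n\<close> by simp
  qed
  have "(\<lambda>n. x (Suc n)) \<longlonglongrightarrow> 0"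
    using sx by (intro LIMSEQ_Suc summable_LIMSEQ_zero)
  then have "\<forall>\<^sub>F n in sequentially. x (Suc n) < \<delta>"
    using \<open>\<delta> > 0\<close> by (rule order_tendstoD)
  then obtain M where M: "x (Suc n) < \<delta>" if "n \<ge> M" for n
    by (auto simp: eventually_sequentially)
  obtain n where "n \<ge> max N M" "real n * c n < \<delta> / 2"
    using summable_imp_frequently_small[OF sc, of "\<delta> / 2" "max N M"] \<open>\<delta> > 0\<close> by auto
  then show False
    using Q_ge[of n] M[of n] by (simp add: Q_def)
qed

end
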